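(* Let $G$ be an HRLQ instance admitting a feasible envy-free matching, let $\ell_1$ be the maximum length of a resident's preference list and $\ell_2$ the maximum length of a hospital's preference list, and let $OPT$ be a maximum-size feasible envy-free matching of $G$. Let $M$ be any maximal envy-free matching of $G$. Then (I) if every hospital has quotas at most $1$, $|OPT|\le \ell_1\cdot|M|$ (i.e. $M$ is an $\ell_1$-approximation); (II) for arbitrary quotas, $|OPT|\le \ell_1\ell_2\cdot |M|$ (i.e. $M$ is an $(\ell_1\cdot\ell_2)$-approximation).
   Context: An HRLQ instance is a bipartite graph $G=(\mathcal{R}\cup\mathcal{H},E)$ with residents $\mathcal{R}$ and hospitals $\mathcal{H}$; $(r,h)\in E$ means mutual acceptability. Each hospital $h$ has an upper quota $q^+(h)$ and a lower quota $q^-(h)\le q^+(h)$. Every vertex ranks its neighbours strictly; $b_1>_a b_2$ means $a$ prefers $b_1$ to $b_2$; the preference list length of a vertex is its degree. A matching $M\subseteq E$ assigns each resident at most one hospital and each hospital $h$ at most $q^+(h)$ residents; $M(r)$ is $r$'s hospital ($\bot$ if unmatched, worst for $r$). $M$ is feasible if $|M(h)|\ge q^-(h)$ for all $h$. A resident $r$ envies a matched resident $r'$ with $M(r')=h$, $(r,h)\in E$, if $h>_r M(r)$ and $r>_h r'$; $M$ is envy-free if no such pair exists. An envy-free matching $M$ is a maximal envy-free matching if adding any edge of $E\setminus M$ to $M$ violates an upper quota or envy-freeness. *)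

theory Defs
  imports Main
begin

record ('r, 'h) hrlq =
  residents :: "'r set"
  hospitals :: "'h set"
  edges :: "('r \<times> 'h) set"
  upper :: "'h \<Rightarrow> nat"
  lower :: "'h \<Rightarrow> nat"
  rpref :: "'r \<Rightarrow> 'h rel"  \<comment> \<open>\<open>(h1, h2) \<in> rpref G r\<close>: \<open>r\<close> prefers \<open>h1\<close> to \<open>h2\<close>\<close>
  hpref :: "'h \<Rightarrow> 'r rel"  \<comment> \<open>\<open>(r1, r2) \<in> hpref G h\<close>: \<open>h\<close> prefers \<open>r1\<close> to \<open>r2\<close>\<close>

definition rnbrs :: "('r, 'h) hrlq \<Rightarrow> 'r \<Rightarrow> 'h set" where
  "rnbrs G r = {h. (r, h) \<in> edges G}"

definition hnbrs :: "('r, 'h) hrlq \<Rightarrow> 'h \<Rightarrow> 'r set" where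
  "hnbrs G h = {r. (r, h) \<in> edges G}"

definition hrlq_instance :: "('r, 'h) hrlq \<Rightarrow> bool" where
  "hrlq_instance G \<longleftrightarrow>
     finite (residents G) \<and> finite (hospitals G) \<and>
     edges G \<subseteq> residents G \<times> hospitals G \<and>
     (\<forall>h\<in>hospitals G. lower G h \<le> upper G h) \<and>
     (\<forall>r\<in>residents G. rpref G r \<subseteq> rnbrs G r \<times> rnbrs G r \<and>
        strict_linear_order_on (rnbrs G r) (rpref G r)) \<and>
     (\<forall>h\<in>hospitals G. hpref G h \<subseteq> hnbrs G h \<times> hnbrs G h \<and>
        strict_linear_order_on (hnbrs G h) (hpref G h))"

text \<open>The next two are meaningful only if there is at least one resident (hospital):
  \<open>Max {}\<close> is unspecified.\<close>

definition max_resident_list :: "('r, 'h) hrlq \<Rightarrow> nat" where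
  "max_resident_list G = Max ((\<lambda>r. card (rnbrs G r)) ` residents G)"

definition max_hospital_list :: "('r, 'h) hrlq \<Rightarrow> nat" where
  "max_hospital_list G = Max ((\<lambda>h. card (hnbrs G h)) ` hospitals G)"

definition matching :: "('r, 'h) hrlq \<Rightarrow> ('r \<times> 'h) set \<Rightarrow> bool" where
  "matching G M \<longleftrightarrow>
     M \<subseteq> edges G \<and>
     (\<forall>r\<in>residents G. card {h. (r, h) \<in> M} \<le> 1) \<and>
     (\<forall>h\<in>hospitals G. card {r. (r, h) \<in> M} \<le> upper G h)"

definition feasible :: "('r, 'h) hrlq \<Rightarrow> ('r \<times> 'h) set \<Rightarrow> bool" where
  "feasible G M \<longleftrightarrow> (\<forall>h\<in>hospitals G. lower G h \<le> card {r. (r, h) \<in> M})"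

text \<open>\<open>None\<close> plays the role of \<open>\<bottom>\<close>.\<close>

definition partner :: "('r \<times> 'h) set \<Rightarrow> 'r \<Rightarrow> 'h option" where
  "partner M r = (if \<exists>h. (r, h) \<in> M then Some (THE h. (r, h) \<in> M) else None)"

fun prefers :: "('r, 'h) hrlq \<Rightarrow> 'r \<Rightarrow> 'h \<Rightarrow> 'h option \<Rightarrow> bool" where
  "prefers G r h None \<longleftrightarrow> True"
| "prefers G r h (Some h') \<longleftrightarrow> (h, h') \<in> rpref G r"

definition envies :: "('r, 'h) hrlq \<Rightarrow> ('r \<times> 'h) set \<Rightarrow> 'r \<Rightarrow> 'r \<Rightarrow> bool" where
  "envies G M r r' \<longleftrightarrow>
     (\<exists>h. partner M r' = Some h \<and> (r, h) \<in> edges G \<and>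
          prefers G r h (partner M r) \<and> (r, r') \<in> hpref G h)"

definition envy_free_matching :: "('r, 'h) hrlq \<Rightarrow> ('r \<times> 'h) set \<Rightarrow> bool" where
  "envy_free_matching G M \<longleftrightarrow>
     matching G M \<and> (\<forall>r\<in>residents G. \<forall>r'\<in>residents G. \<not> envies G M r r')"

definition feasible_envy_free_matching :: "('r, 'h) hrlq \<Rightarrow> ('r \<times> 'h) set \<Rightarrow> bool" where
  "feasible_envy_free_matching G M \<longleftrightarrow> envy_free_matching G M \<and> feasible G M"

text \<open>The upper quota of a resident is 1, so adding an edge at an already matched resident
  counts as violating an upper quota. Feasibility is not required.\<close>

definition maximal_envy_free_matching :: "('r, 'h) hrlq \<Rightarrow> ('r \<times> 'h) set \<Rightarrow> bool" where
  "maximal_envy_free_matching G M \<longleftrightarrow>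
     envy_free_matching G M \<and>
     (\<forall>e\<in>edges G - M. \<not> envy_free_matching G (insert e M))"

end

theory Submission
  imports Defs
begin

text \<open>In a maximal envy-free matching \<open>M\<close>, every hospital with a neighbour and a positive upper quota has a matched neighbour: otherwise
  it could be given its favourite neighbour, whom nobody can envy there. Hence the hospitals used
  by any matching lie in the neighbourhood of the residents matched by \<open>M\<close>, and there are
  at most \<open>l1 * card M\<close> of them.\<close>

lemma finite_edges:
  assumes "hrlq_instance G"
  shows "finite (edges G)"
  using assms by (auto simp: hrlq_instance_def intro: finite_subset)

lemma finite_rnbrs:
  assumes "hrlq_instance G"
  shows "finite (rnbrs G r)"
proof (rule finite_subset)
  show "rnbrs G r \<subseteq> snd ` edges G" by (force simp: rnbrs_def)
qed (simp add: finite_edges[OF assms])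

lemma finite_hnbrs:
  assumes "hrlq_instance G"
  shows "finite (hnbrs G h)"
proof (rule finite_subset)
  show "hnbrs G h \<subseteq> fst ` edges G" by (force simp: hnbrs_def)
qed (simp add: finite_edges[OF assms])

lemma card_rnbrs_le:
  assumes "hrlq_instance G" "r \<in> residents G"
  shows "card (rnbrs G r) \<le> max_resident_list G"
  using assms by (auto simp: max_resident_list_def hrlq_instance_def intro: Max_ge)

lemma card_hnbrs_le:
  assumes "hrlq_instance G" "h \<in> hospitals G"
  shows "card (hnbrs G h) \<le> max_hospital_list G"
  using assms by (auto simp: max_hospital_list_def hrlq_instance_def intro: Max_ge)

lemma favourite_neighbour:
  assumes G: "hrlq_instance G" and "(r, h) \<in> edges G"
  obtains t where "(t, h) \<in> edges G" "\<And>s. (s, t) \<notin> hpref G h"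
proof -
  have "h \<in> hospitals G" using assms by (auto simp: hrlq_instance_def)
  then have sub: "hpref G h \<subseteq> hnbrs G h \<times> hnbrs G h"
    and lin: "strict_linear_order_on (hnbrs G h) (hpref G h)"
    using G by (auto simp: hrlq_instance_def)
  have "finite (hpref G h)"
    using finite_subset[OF sub] finite_hnbrs[OF G] by blast
  moreover have "acyclic (hpref G h)"
    using lin by (simp add: strict_linear_order_on_def acyclic_irrefl)
  ultimately have "wf (hpref G h)" by (rule finite_acyclic_wf)
  moreover have "r \<in> hnbrs G h" using assms(2) by (simp add: hnbrs_def)
  ultimately obtain t where "t \<in> hnbrs G h" "\<And>s. (s, t) \<in> hpref G h \<Longrightarrow> s \<notin> hnbrs G h"
    by (rule wfE_min) blast
  with sub show thesis using that[of t] by (auto simp: hnbrs_def)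
qed

lemma partner_insert_same:
  assumes "\<And>h'. (t, h') \<notin> M"
  shows "partner (insert (t, h) M) t = Some h"
  using assms by (auto simp: partner_def)

lemma partner_insert_other:
  assumes "r \<noteq> t"
  shows "partner (insert (t, h) M) r = partner M r"
  using assms by (simp add: partner_def)

lemma matching_insert:
  assumes M: "matching G M" and e: "(t, h) \<in> edges G" and up: "0 < upper G h"
    and t: "\<And>h'. (t, h') \<notin> M" and h: "\<And>r. (r, h) \<notin> M"
  shows "matching G (insert (t, h) M)"
proof -
  have r: "{h'. (r, h') \<in> insert (t, h) M} = (if r = t then {h} else {h'. (r, h') \<in> M})" for r
    using t by auto
  have h: "{r. (r, h') \<in> insert (t, h) M} = (if h' = h then {t} else {r. (r, h') \<in> M})" for h'
    using h by auto
  show ?thesis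
    unfolding matching_def r h using M e up by (auto simp: matching_def)
qed

lemma envy_free_insert:
  assumes M: "envy_free_matching G M" and e: "(t, h) \<in> edges G" and up: "0 < upper G h"
    and t: "\<And>h'. (t, h') \<notin> M" and h: "\<And>r. (r, h) \<notin> M"
    and top: "\<And>s. (s, t) \<notin> hpref G h"
  shows "envy_free_matching G (insert (t, h) M)"
proof -
  have "envies G M r r'" if env: "envies G (insert (t, h) M) r r'" for r r'
  proof -
    have "r' \<noteq> t"
      using env top partner_insert_same[OF t] by (auto simp: envies_def)
    moreover have "partner M t = None" using t by (simp add: partner_def)
    ultimately show ?thesis
      using env by (cases "r = t") (auto simp: envies_def partner_insert_other)
  qed
  then show ?thesis
    using M matching_insert[OF _ e up t h] by (auto simp: envy_free_matching_def)
qed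

lemma maximal_envy_free_covers:
  assumes G: "hrlq_instance G" and M: "maximal_envy_free_matching G M"
    and e: "(r, h) \<in> edges G" and up: "0 < upper G h"
  shows "h \<in> (\<Union>s\<in>fst ` M. rnbrs G s)"
proof (rule ccontr)
  assume "h \<notin> (\<Union>s\<in>fst ` M. rnbrs G s)"
  then have unmatched: "(s, h') \<notin> M" if "(s, h) \<in> edges G" for s h'
    using that by (force simp: rnbrs_def)
  have ef: "envy_free_matching G M" and "M \<subseteq> edges G"
    using M by (auto simp: maximal_envy_free_matching_def envy_free_matching_def matching_def)
  then have empty: "(s, h) \<notin> M" for s using unmatched by blast
  obtain t where t: "(t, h) \<in> edges G" and top: "\<And>s. (s, t) \<notin> hpref G h"
    using favourite_neighbour[OF G e] by blast
  have "envy_free_matching G (insert (t, h) M)"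
    using envy_free_insert[OF ef t up unmatched[OF t] empty top] .
  then show False
    using M t empty by (auto simp: maximal_envy_free_matching_def)
qed

lemma card_matched_hospitals_le:
  assumes G: "hrlq_instance G" and M: "maximal_envy_free_matching G M" and N: "matching G N"
  shows "card (snd ` N) \<le> max_resident_list G * card M"
proof -
  have sub: "M \<subseteq> edges G"
    using M by (auto simp: maximal_envy_free_matching_def envy_free_matching_def matching_def)
  then have fin: "finite M" using finite_edges[OF G] finite_subset by blast
  have N_sub: "N \<subseteq> edges G" using N by (simp add: matching_def)
  then have N_fin: "finite N" using finite_edges[OF G] finite_subset by blast
  have "snd ` N \<subseteq> (\<Union>s\<in>fst ` M. rnbrs G s)"
  proof clarify
    fix r h assume rh: "(r, h) \<in> N"
    have "finite {r. (r, h) \<in> N}"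
      by (rule finite_subset[OF _ finite_imageI[OF N_fin, of fst]]) force
    then have "0 < card {r. (r, h) \<in> N}" using rh by (auto simp: card_gt_0_iff)
    moreover have "h \<in> hospitals G" using rh N_sub G by (auto simp: hrlq_instance_def)
    ultimately have "0 < upper G h" using N by (fastforce simp: matching_def)
    then show "snd (r, h) \<in> (\<Union>s\<in>fst ` M. rnbrs G s)"
      using maximal_envy_free_covers[OF G M] rh N_sub by auto
  qed
  then have "card (snd ` N) \<le> card (\<Union>s\<in>fst ` M. rnbrs G s)"
    using fin finite_rnbrs[OF G] by (intro card_mono) auto
  also have "\<dots> \<le> (\<Sum>s\<in>fst ` M. card (rnbrs G s))"
    using fin by (intro card_UN_le) simp
  also have "\<dots> \<le> (\<Sum>s\<in>fst ` M. max_resident_list G)"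
    using sub G by (intro sum_mono card_rnbrs_le) (auto simp: hrlq_instance_def)
  also have "\<dots> \<le> max_resident_list G * card M"
    using card_image_le[OF fin, of fst] by (simp add: mult.commute)
  finally show ?thesis .
qed

lemma card_le_matched_hospitals:
  assumes "finite N" and "\<And>h. h \<in> snd ` N \<Longrightarrow> card {r. (r, h) \<in> N} \<le> k"
  shows "card N \<le> card (snd ` N) * k"
proof -
  have "finite {r. (r, h) \<in> N}" for h
    by (rule finite_subset[OF _ finite_imageI[OF assms(1), of fst]]) force
  moreover have "N = (\<lambda>(h, r). (r, h)) ` (SIGMA h:snd ` N. {r. (r, h) \<in> N})"
    by force
  ultimately have "card N \<le> (\<Sum>h\<in>snd ` N. card {r. (r, h) \<in> N})"
    using assms(1) card_image_le[of "SIGMA h:snd ` N. {r. (r, h) \<in> N}" "\<lambda>(h, r). (r, h)"]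
    by (simp add: card_SigmaI)
  also have "\<dots> \<le> card (snd ` N) * k"
    using sum_bounded_above[of "snd ` N" "\<lambda>h. card {r. (r, h) \<in> N}" k] assms(2) by simp
  finally show ?thesis .
qed

theorem theorem3:
  fixes G :: "('r, 'h) hrlq" and OPT M :: "('r \<times> 'h) set" and l1 l2 :: nat
  assumes "hrlq_instance G"
    and "\<exists>N. feasible_envy_free_matching G N"
    and "l1 = max_resident_list G"
    and "l2 = max_hospital_list G"
    and "is_arg_max card (feasible_envy_free_matching G) OPT"
    and "maximal_envy_free_matching G M"
  shows "((\<forall>h\<in>hospitals G. upper G h \<le> 1 \<and> lower G h \<le> 1) \<longrightarrow> card OPT \<le> l1 * card M) \<and>
         card OPT \<le> l1 * l2 * card M"
proof (intro conjI impI)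
  have OPT: "matching G OPT"
    using assms(5)
    by (simp add: is_arg_max_def feasible_envy_free_matching_def envy_free_matching_def)
  then have sub: "OPT \<subseteq> edges G" by (simp add: matching_def)
  then have fin: "finite OPT" using finite_edges[OF assms(1)] finite_subset by blast
  have hosp: "h \<in> hospitals G" if "h \<in> snd ` OPT" for h
    using that sub assms(1) by (auto simp: hrlq_instance_def)
  have used: "card (snd ` OPT) \<le> l1 * card M"
    using card_matched_hospitals_le[OF assms(1,6) OPT] assms(3) by simp
  show "card OPT \<le> l1 * card M"
    if unit: "\<forall>h\<in>hospitals G. upper G h \<le> 1 \<and> lower G h \<le> 1"
  proof -
    have "card {r. (r, h) \<in> OPT} \<le> 1" if "h \<in> snd ` OPT" for h
      using unit OPT hosp[OF that] unfolding matching_def by (blast intro: le_trans)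
    then show ?thesis using card_le_matched_hospitals[OF fin, of 1] used by simp
  qed
  have "card {r. (r, h) \<in> OPT} \<le> l2" if "h \<in> snd ` OPT" for h
  proof -
    have "card {r. (r, h) \<in> OPT} \<le> card (hnbrs G h)"
      using sub by (intro card_mono finite_hnbrs[OF assms(1)]) (auto simp: hnbrs_def)
    then show ?thesis using card_hnbrs_le[OF assms(1) hosp[OF that]] assms(4) by simp
  qed
  then have "card OPT \<le> card (snd ` OPT) * l2"
    by (rule card_le_matched_hospitals[OF fin])
  also have "\<dots> \<le> l1 * card M * l2" using used by (rule mult_right_mono) simp
  finally show "card OPT \<le> l1 * l2 * card M" by (simp add: ac_simps)
qed

end
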